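(* The minimum rank oracle (Min) is not polynomially reducible to any of the following: the rank sum oracle (Sum), the common independence oracle (CI), the maximum rank oracle (Max), and the combined oracle CI+Max.
   Context: Let $\mathbf{M}_1=(E,\mathcal{I}_1)$, $\mathbf{M}_2=(E,\mathcal{I}_2)$ be loopless matroids on a common finite ground set $E$ with rank functions $r_1,r_2$. For a queried $X\subseteq E$: Sum returns $r_1(X)+r_2(X)$; Min returns $\min\{r_1(X),r_2(X)\}$; Max returns $\max\{r_1(X),r_2(X)\}$; CI returns ``Yes'' if $X\in\mathcal{I}_1\cap\mathcal{I}_2$ and ``No'' otherwise; CI+Max returns both the CI answer and the Max answer for $X$. An oracle $\mathcal{O}_1$ is polynomially reducible to an oracle $\mathcal{O}_2$ if, for every such pair of matroids, the answer of $\mathcal{O}_1$ to any query can be computed using a number of calls to $\mathcal{O}_2$ bounded by a polynomial in $|E|$ (in particular, the answers of $\mathcal{O}_2$ must determine those of $\mathcal{O}_1$). *)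

theory Defs
  imports Complex_Main "HOL-Computational_Algebra.Polynomial" "HOL-Library.Infinite_Typeclass"
begin

locale matroid =
  fixes E :: "'a set" and \<I> :: "'a set set"
  assumes finite_ground: "finite E"
    and indep_subset_ground: "\<I> \<subseteq> Pow E"
    and empty_indep: "{} \<in> \<I>"
    and indep_subset: "\<lbrakk>Y \<in> \<I>; X \<subseteq> Y\<rbrakk> \<Longrightarrow> X \<in> \<I>"
    and augment: "\<lbrakk>X \<in> \<I>; Y \<in> \<I>; card X < card Y\<rbrakk> \<Longrightarrow> \<exists>y \<in> Y - X. insert y X \<in> \<I>"

locale loopless_matroid = matroid +
  assumes loopless: "e \<in> E \<Longrightarrow> {e} \<in> \<I>"

definition rank :: "'a set set \<Rightarrow> 'a set \<Rightarrow> nat" where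
  "rank \<I> X = Max (card ` {Y \<in> \<I>. Y \<subseteq> X})"

text \<open>These maps take the independent sets of the two matroids and a queried set to the answer.\<close>

type_synonym ('a, 'r) matroid_oracle = "'a set set \<Rightarrow> 'a set set \<Rightarrow> 'a set \<Rightarrow> 'r"

definition sum_oracle :: "('a, nat) matroid_oracle" where
  "sum_oracle \<I>1 \<I>2 X = rank \<I>1 X + rank \<I>2 X"

definition min_oracle :: "('a, nat) matroid_oracle" where
  "min_oracle \<I>1 \<I>2 X = min (rank \<I>1 X) (rank \<I>2 X)"

definition max_oracle :: "('a, nat) matroid_oracle" where
  "max_oracle \<I>1 \<I>2 X = max (rank \<I>1 X) (rank \<I>2 X)"

definition ci_oracle :: "('a, bool) matroid_oracle" where
  "ci_oracle \<I>1 \<I>2 X \<longleftrightarrow> X \<in> \<I>1 \<inter> \<I>2"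

definition ci_max_oracle :: "('a, bool \<times> nat) matroid_oracle" where
  "ci_max_oracle \<I>1 \<I>2 X = (ci_oracle \<I>1 \<I>2 X, max_oracle \<I>1 \<I>2 X)"

text \<open>Deterministic adaptive query procedures: each query may depend on all earlier answers, and
  computation between queries is unrestricted, since only the queries are counted.\<close>

datatype ('q, 'r, 'b) query_procedure =
    Return 'b
  | Query 'q "'r \<Rightarrow> ('q, 'r, 'b) query_procedure"

primrec run :: "('q \<Rightarrow> 'r) \<Rightarrow> ('q, 'r, 'b) query_procedure \<Rightarrow> 'b" where
  "run f (Return b) = b"
| "run f (Query q k) = run f (k (f q))"

primrec queries :: "('q \<Rightarrow> 'r) \<Rightarrow> ('q, 'r, 'b) query_procedure \<Rightarrow> 'q list" where
  "queries f (Return b) = []"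
| "queries f (Query q k) = q # queries f (k (f q))"

text \<open>The procedure is chosen knowing only the ground set and the set whose \<open>\<O>1\<close>-answer is wanted;
  the matroids are accessible only through \<open>\<O>2\<close>.\<close>

definition polynomially_reducible :: "('a, 'b) matroid_oracle \<Rightarrow> ('a, 'r) matroid_oracle \<Rightarrow> bool" where
  "polynomially_reducible \<O>1 \<O>2 \<longleftrightarrow>
     (\<exists>(A :: 'a set \<Rightarrow> 'a set \<Rightarrow> ('a set, 'r, 'b) query_procedure) (p :: real poly).
        \<forall>E \<I>1 \<I>2 X. loopless_matroid E \<I>1 \<longrightarrow> loopless_matroid E \<I>2 \<longrightarrow> X \<subseteq> E \<longrightarrow>
          run (\<O>2 \<I>1 \<I>2) (A E X) = \<O>1 \<I>1 \<I>2 X \<and>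
          set (queries (\<O>2 \<I>1 \<I>2) (A E X)) \<subseteq> Pow E \<and>
          real (length (queries (\<O>2 \<I>1 \<I>2) (A E X))) \<le> poly p (real (card E)))"

end

theory Submission
  imports Defs
begin

text \<open>On a four-element ground set \<open>A \<union> B\<close> with \<open>|A| = |B| = 2\<close>, write \<open>(k, l)\<close> for the matroid in
  which \<open>X\<close> is independent iff \<open>|X \<inter> A| \<le> k\<close> and \<open>|X \<inter> B| \<le> l\<close>. The pair \<open>(1,2), (2,1)\<close> has
  minimum rank 3. It has the same rank sums as the pair \<open>(2,2), (1,1)\<close>, and, since
  the union of its families of independent sets is the uniform matroid \<open>U\<close> of rank 3 and their intersection
  is \<open>(1,1)\<close>, it has the same common independent sets and the same maximum ranks as \<open>U, (1,1)\<close>.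
  Both of these other pairs have minimum rank 2, so no number of queries suffices.\<close>

text \<open>The blocks are parameters so that an empty one is possible: with \<open>B = {}\<close>
  this is the uniform matroid on \<open>A\<close>, cut off at rank \<open>k\<close>.\<close>

definition partition_indep :: "'a set \<Rightarrow> nat \<Rightarrow> 'a set \<Rightarrow> nat \<Rightarrow> 'a set set" where
  "partition_indep A k B l = {X. X \<subseteq> A \<union> B \<and> card (X \<inter> A) \<le> k \<and> card (X \<inter> B) \<le> l}"

lemma card_partition:
  assumes "finite A" "finite B" "A \<inter> B = {}" "X \<subseteq> A \<union> B"
  shows "card X = card (X \<inter> A) + card (X \<inter> B)"
proof -
  have "X = (X \<inter> A) \<union> (X \<inter> B)" using assms(4) by blast
  moreover have "card ((X \<inter> A) \<union> (X \<inter> B)) = card (X \<inter> A) + card (X \<inter> B)"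
    using assms by (intro card_Un_disjoint) auto
  ultimately show ?thesis by simp
qed

text \<open>A new element of \<open>A\<close> leaves the count in \<open>B\<close> alone and raises
  the count in \<open>A\<close> to at most that of \<open>Y\<close>, so both capacities are still
  respected.\<close>

lemma partition_indep_augment_left:
  assumes fin: "finite A" and disj: "A \<inter> B = {}"
    and X: "X \<in> partition_indep A k B l" and Y: "Y \<in> partition_indep A k B l"
    and less: "card (X \<inter> A) < card (Y \<inter> A)"
  shows "\<exists>y \<in> Y - X. insert y X \<in> partition_indep A k B l"
proof -
  have "\<not> Y \<inter> A \<subseteq> X \<inter> A"
    using less fin by (meson card_mono finite_Int leD)
  then obtain y where y: "y \<in> Y" "y \<in> A" "y \<notin> X" by blast
  have "insert y X \<inter> A = insert y (X \<inter> A)" "insert y X \<inter> B = X \<inter> B"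
    using y disj by auto
  then have "insert y X \<in> partition_indep A k B l"
    using X Y y less fin by (auto simp: partition_indep_def)
  with y show ?thesis by blast
qed

lemma partition_indep_commute: "partition_indep A k B l = partition_indep B l A k"
  by (auto simp: partition_indep_def)

lemma loopless_matroid_partition_indep:
  assumes fin: "finite A" "finite B" and disj: "A \<inter> B = {}" and pos: "0 < k" "0 < l"
  shows "loopless_matroid (A \<union> B) (partition_indep A k B l)"
proof
  show "finite (A \<union> B)" using fin by simp
  show "partition_indep A k B l \<subseteq> Pow (A \<union> B)" "{} \<in> partition_indep A k B l"
    by (auto simp: partition_indep_def)
  show "X \<in> partition_indep A k B l" if "Y \<in> partition_indep A k B l" "X \<subseteq> Y" for X Y
  proof -
    have "card (X \<inter> A) \<le> card (Y \<inter> A)" "card (X \<inter> B) \<le> card (Y \<inter> B)"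
      using that fin by (auto intro!: card_mono)
    with that show ?thesis by (auto simp: partition_indep_def)
  qed
  show "{e} \<in> partition_indep A k B l" if "e \<in> A \<union> B" for e
    using that pos by (auto simp: partition_indep_def Int_insert_left)
  show "\<exists>y \<in> Y - X. insert y X \<in> partition_indep A k B l"
    if X: "X \<in> partition_indep A k B l" and Y: "Y \<in> partition_indep A k B l"
      and less: "card X < card Y" for X Y
  proof -
    have "card X = card (X \<inter> A) + card (X \<inter> B)" "card Y = card (Y \<inter> A) + card (Y \<inter> B)"
      using X Y fin disj by (auto simp: partition_indep_def intro!: card_partition)
    \<comment> \<open>If \<open>Y\<close> is larger in total, it is larger in some block, and
      augmentation takes place there.\<close>
    with less consider "card (X \<inter> A) < card (Y \<inter> A)" | "card (X \<inter> B) < card (Y \<inter> B)"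
      by linarith
    then show ?thesis
    proof cases
      case 1
      with X Y fin disj show ?thesis by (intro partition_indep_augment_left)
    next
      case 2
      with X Y fin disj show ?thesis
        \<comment> \<open>Fixing \<open>A\<close> and \<open>k\<close> makes the rewriting swap the
          blocks, which turns this case into the previous one.\<close>
        unfolding partition_indep_commute[of A k]
        by (intro partition_indep_augment_left) auto
    qed
  qed
qed

text \<open>The blocks do not interact: each bounds its own share of an independent subset, and the
  two bounds are attained together by a union \<open>S \<union> T\<close> of subsets chosen block by
  block.\<close>

lemma rank_partition_indep:
  assumes fin: "finite A" "finite B" and disj: "A \<inter> B = {}"
  shows "rank (partition_indep A k B l) X = min (card (X \<inter> A)) k + min (card (X \<inter> B)) l"
  unfolding rank_def
proof (rule Max_eqI)
  have "partition_indep A k B l \<subseteq> Pow (A \<union> B)" by (auto simp: partition_indep_def)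
  then have "finite (partition_indep A k B l)" using fin by (meson finite_Pow_iff finite_Un finite_subset)
  then show "finite (card ` {Y \<in> partition_indep A k B l. Y \<subseteq> X})" by simp
next
  fix n assume "n \<in> card ` {Y \<in> partition_indep A k B l. Y \<subseteq> X}"
  then obtain Y where Y: "Y \<in> partition_indep A k B l" "Y \<subseteq> X" "n = card Y" by blast
  have "card (Y \<inter> A) \<le> card (X \<inter> A)" "card (Y \<inter> B) \<le> card (X \<inter> B)"
    using Y fin by (auto intro!: card_mono)
  moreover have "card Y = card (Y \<inter> A) + card (Y \<inter> B)"
    using Y fin disj by (auto simp: partition_indep_def intro!: card_partition)
  ultimately show "n \<le> min (card (X \<inter> A)) k + min (card (X \<inter> B)) l"
    using Y by (auto simp: partition_indep_def)
next
  obtain S where S: "S \<subseteq> X \<inter> A" "card S = min (card (X \<inter> A)) k"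
    by (meson min.cobounded1 obtain_subset_with_card_n)
  obtain T where T: "T \<subseteq> X \<inter> B" "card T = min (card (X \<inter> B)) l"
    by (meson min.cobounded1 obtain_subset_with_card_n)
  have "(S \<union> T) \<inter> A = S" "(S \<union> T) \<inter> B = T" using S T disj by auto
  then have "S \<union> T \<in> partition_indep A k B l" "card (S \<union> T) = card S + card T"
    using S T card_partition[OF fin disj, of "S \<union> T"] by (auto simp: partition_indep_def)
  moreover have "S \<union> T \<subseteq> X" using S T by blast
  ultimately show "min (card (X \<inter> A)) k + min (card (X \<inter> B)) l
      \<in> card ` {Y \<in> partition_indep A k B l. Y \<subseteq> X}"
    using S(2) T(2) by (metis (mono_tags, lifting) image_eqI mem_Collect_eq)
qed

text \<open>The procedure depends only on \<open>E\<close> and \<open>X\<close>, so it runs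
  identically on both pairs and returns one value where two different ones are due. Agreement on
  every \<open>Y\<close> makes the two answer functions equal, so the runs coincide by
  rewriting.\<close>

lemma not_polynomially_reducible_if_indistinguishable:
  assumes "loopless_matroid E \<I>1" "loopless_matroid E \<I>2"
    and "loopless_matroid E \<J>1" "loopless_matroid E \<J>2"
    and "X \<subseteq> E" and same: "\<And>Y. \<O>2 \<I>1 \<I>2 Y = \<O>2 \<J>1 \<J>2 Y"
    and differ: "\<O>1 \<I>1 \<I>2 X \<noteq> \<O>1 \<J>1 \<J>2 X"
  shows "\<not> polynomially_reducible \<O>1 \<O>2"
proof
  assume "polynomially_reducible \<O>1 \<O>2"
  then obtain A p where
    "\<forall>E \<I>1 \<I>2 X. loopless_matroid E \<I>1 \<longrightarrow> loopless_matroid E \<I>2 \<longrightarrow> X \<subseteq> E \<longrightarrow>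
      run (\<O>2 \<I>1 \<I>2) (A E X) = \<O>1 \<I>1 \<I>2 X \<and>
      set (queries (\<O>2 \<I>1 \<I>2) (A E X)) \<subseteq> Pow E \<and>
      real (length (queries (\<O>2 \<I>1 \<I>2) (A E X))) \<le> poly p (real (card E))"
    unfolding polynomially_reducible_def by (elim exE)
  then have A: "run (\<O>2 \<K>1 \<K>2) (A E X) = \<O>1 \<K>1 \<K>2 X"
    if "loopless_matroid E \<K>1" "loopless_matroid E \<K>2" for \<K>1 \<K>2
    using that \<open>X \<subseteq> E\<close> by simp
  have "\<O>2 \<I>1 \<I>2 = \<O>2 \<J>1 \<J>2" using same by (rule ext)
  with A[OF assms(1,2)] A[OF assms(3,4)] differ show False by simp
qed

theorem theorem3p2:
  shows "\<not> polynomially_reducible (min_oracle :: ('a::infinite, nat) matroid_oracle) sum_oracle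
    \<and> \<not> polynomially_reducible (min_oracle :: ('a::infinite, nat) matroid_oracle) ci_oracle
    \<and> \<not> polynomially_reducible (min_oracle :: ('a::infinite, nat) matroid_oracle) max_oracle
    \<and> \<not> polynomially_reducible (min_oracle :: ('a::infinite, nat) matroid_oracle) ci_max_oracle"
proof -
  obtain E :: "'a set" where E: "finite E" "card E = 4"
    using infinite_arbitrarily_large[OF infinite_UNIV] by blast
  then obtain A where A: "A \<subseteq> E" "card A = 2" "finite A"
    using obtain_subset_with_card_n[of 2 E] by auto
  define B where "B = E - A"
  have fin: "finite A" "finite B" and disj: "A \<inter> B = {}" and card: "card A = 2" "card B = 2"
    using A E by (auto simp: B_def card_Diff_subset)
  let ?M = "\<lambda>k l. partition_indep A k B l"
  \<comment> \<open>Capacity 1 on the empty block only meets the positivity condition for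
    looplessness.\<close>
  let ?U = "partition_indep (A \<union> B) 3 {} 1"
  have loopless: "loopless_matroid (A \<union> B) (?M k l)" if "0 < k" "0 < l" for k l
    using fin disj that by (rule loopless_matroid_partition_indep)
  have loopless_U: "loopless_matroid (A \<union> B) ?U"
    using loopless_matroid_partition_indep[of "A \<union> B" "{}" 3 1] fin by simp
  have rank: "rank (?M k l) X = min (card (X \<inter> A)) k + min (card (X \<inter> B)) l" for k l X
    using fin disj by (rule rank_partition_indep)
  have card_Int_Un: "card (X \<inter> (A \<union> B)) = card (X \<inter> A) + card (X \<inter> B)" for X
    using card_partition[OF fin disj, of "X \<inter> (A \<union> B)"] by (simp add: Int_assoc Int_absorb1)
  have rank_U: "rank ?U X = min (card (X \<inter> A) + card (X \<inter> B)) 3" for X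
    using rank_partition_indep[of "A \<union> B" "{}" 3 1 X] fin by (simp add: card_Int_Un)
  have le2: "card (X \<inter> A) \<le> 2" "card (X \<inter> B) \<le> 2" for X
    using card_mono[OF fin(1), of "X \<inter> A"] card_mono[OF fin(2), of "X \<inter> B"] card by auto
  have top: "card ((A \<union> B) \<inter> A) = 2" "card ((A \<union> B) \<inter> B) = 2"
    using card by (simp_all add: Int_absorb1)
  \<comment> \<open>Both sides add the same four truncated counts in a different order.\<close>
  have sum: "sum_oracle (?M 1 2) (?M 2 1) X = sum_oracle (?M 2 2) (?M 1 1) X" for X
    by (simp only: sum_oracle_def rank ac_simps)
  have max: "max_oracle (?M 1 2) (?M 2 1) X = max_oracle ?U (?M 1 1) X" for X
  proof -
    \<comment> \<open>Here \<open>x\<close> and \<open>y\<close> count the elements in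
      \<open>A\<close> and \<open>B\<close>. Unless both are 2, one is at most 1 and both sides
      equal \<open>x + y\<close>; for two 2s both sides equal 3.\<close>
    have "max (min x 1 + min y 2) (min x 2 + min y 1) = max (min (x + y) 3) (min x 1 + min y 1)"
      if "x \<le> 2" "y \<le> 2" for x y :: nat
    proof -
      have "x = 0 \<or> x = 1 \<or> x = 2" "y = 0 \<or> y = 1 \<or> y = 2" using that by arith+
      then show ?thesis by (elim disjE; hypsubst) simp_all
    qed
    then show ?thesis unfolding max_oracle_def rank rank_U using le2 .
  qed
  \<comment> \<open>On both sides the condition is at most one element per block; such sets have at
    most 2 elements and so lie in \<open>?U\<close>.\<close>
  have ci: "ci_oracle (?M 1 2) (?M 2 1) X = ci_oracle ?U (?M 1 1) X" for X
    by (auto simp: ci_oracle_def partition_indep_def card_Int_Un)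
  have ci_max: "ci_max_oracle (?M 1 2) (?M 2 1) X = ci_max_oracle ?U (?M 1 1) X" for X
    unfolding ci_max_oracle_def max ci ..
  \<comment> \<open>On the whole ground set the ranks are 3 and 3 for the first pair, against 4 and
    2, respectively 3 and 2.\<close>
  have min: "min_oracle (?M 1 2) (?M 2 1) (A \<union> B) \<noteq> min_oracle (?M 2 2) (?M 1 1) (A \<union> B)"
    "min_oracle (?M 1 2) (?M 2 1) (A \<union> B) \<noteq> min_oracle ?U (?M 1 1) (A \<union> B)"
    unfolding min_oracle_def rank rank_U top by simp_all
  note indist = not_polynomially_reducible_if_indistinguishable[where E = "A \<union> B" and X = "A \<union> B"
      and ?\<I>1.0 = "?M 1 2" and ?\<I>2.0 = "?M 2 1" and ?\<J>2.0 = "?M 1 1"]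
  note indist_sum = indist[where ?\<J>1.0 = "?M 2 2" and ?\<O>1.0 = min_oracle]
    and indist_max = indist[where ?\<J>1.0 = ?U and ?\<O>1.0 = min_oracle]
  show ?thesis
  proof (intro conjI)
    show "\<not> polynomially_reducible (min_oracle :: ('a, nat) matroid_oracle) sum_oracle"
      by (rule indist_sum) (rule sum min(1) subset_refl | (rule loopless; simp))+
    show "\<not> polynomially_reducible (min_oracle :: ('a, nat) matroid_oracle) ci_oracle"
      by (rule indist_max) (rule loopless_U ci min(2) subset_refl | (rule loopless; simp))+
    show "\<not> polynomially_reducible (min_oracle :: ('a, nat) matroid_oracle) max_oracle"
      by (rule indist_max) (rule loopless_U max min(2) subset_refl | (rule loopless; simp))+
    show "\<not> polynomially_reducible (min_oracle :: ('a, nat) matroid_oracle) ci_max_oracle"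
      by (rule indist_max) (rule loopless_U ci_max min(2) subset_refl | (rule loopless; simp))+
  qed
qed

end
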